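(* Fix $\sigma > 0$. For each real $\rho > 4$, let $\psi_\rho$ be a positive random variable such that $\psi_\rho^2 \sim \text{Scale-inv-}\chi^2\left(\rho, \frac{1}{\sigma^2}\right)$. Then $\mathrm{Var}[\psi_\rho]$ monotonically decreases as $\rho$ increases; that is, for all real $\rho_1, \rho_2$ with $4 < \rho_1 < \rho_2$, $\mathrm{Var}[\psi_{\rho_2}] < \mathrm{Var}[\psi_{\rho_1}]$.
   Context: For $\rho > 0$ (degrees of freedom, not necessarily an integer) and $\tau^2 > 0$, the scaled inverse chi-squared distribution $\text{Scale-inv-}\chi^2(\rho, \tau^2)$ is the probability distribution on $(0,\infty)$ with density $$p(x) = \frac{(\tau^2\rho/2)^{\rho/2}}{\Gamma(\rho/2)}\,\frac{\exp\left[-\frac{\rho\tau^2}{2x}\right]}{x^{1+\rho/2}},\qquad x > 0,$$ where $\Gamma$ is the gamma function. Here $\tau^2 = 1/\sigma^2$ is held fixed while $\rho$ varies. *)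

theory Defs
  imports "HOL-Probability.Probability"
begin

text \<open>
  Density of the scaled inverse chi-squared distribution with \<open>\<rho>\<close> degrees of freedom,
  extended by 0 outside its support \<open>{0<..}\<close>. The second argument \<open>t\<close> is the squared
  scale \<open>\<tau>\<^sup>2\<close> itself.
\<close>

definition scale_inv_chi2_density :: "real \<Rightarrow> real \<Rightarrow> real \<Rightarrow> real" where
  "scale_inv_chi2_density \<rho> t x =
     (if x > 0
      then (t * \<rho> / 2) powr (\<rho> / 2) / Gamma (\<rho> / 2)
             * (exp (- (\<rho> * t / (2 * x))) / x powr (1 + \<rho> / 2))
      else 0)"

end

theory Submission
  imports Defs
begin

text \<open>
  With \<open>a = \<rho> / 2\<close>, the moments of the inverse gamma distribution show that the variance of
  \<open>\<psi>\<^sub>\<rho>\<close> is \<open>1 / \<sigma>\<^sup>2\<close> times \<open>a / (a - 1) * (1 - Q a)\<close>, where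
  \<open>Q a = \<Gamma>(a - 1/2)\<^sup>2 / (\<Gamma>(a) \<Gamma>(a - 1))\<close>. The first factor is strictly decreasing. Since the
  digamma function has a strictly decreasing derivative, the logarithmic derivative
  \<open>2 * Digamma (a - 1/2) - Digamma a - Digamma (a - 1)\<close> of \<open>Q\<close> is positive, and \<open>Q \<le> 1\<close> by
  log-convexity of \<open>\<Gamma>\<close>; so the second factor is positive and strictly decreasing as well.
\<close>

text \<open>The substitution \<open>x = b / u\<close> maps the half-line onto itself and turns the
  integrand, Jacobian included, into a multiple of Euler's integrand for
  \<open>Gamma s\<close>.\<close>

lemma has_integral_inverse_gamma:
  fixes b s :: real
  assumes b: "b > 0" and s: "s > 0"
  shows "((\<lambda>x. exp (- (b / x)) / x powr (1 + s)) has_integral (Gamma s / b powr s)) {0<..}"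
proof -
  let ?f = "\<lambda>x. exp (- (b / x)) / x powr (1 + s)"
  let ?h = "\<lambda>u. b powr (- s) * (u powr (s - 1) / exp u)"
  have image: "(\<lambda>u. b / u) ` {0<..} = {0<..}"
  proof (intro equalityI subsetI)
    fix x :: real
    assume "x \<in> {0<..}"
    then show "x \<in> (\<lambda>u. b / u) ` {0<..}"
      using b by (intro image_eqI[of _ _ "b / x"]) auto
  qed (use b in auto)
  have pullback: "\<bar>- b / u\<^sup>2\<bar> * ?f (b / u) = ?h u" if "u \<in> {0<..}" for u :: real
  proof -
    have u: "u > 0" using that by simp
    have "(b / u) powr (1 + s) = b * b powr s / (u powr (s - 1) * u\<^sup>2)"
    proof -
      \<comment> \<open>This split of the exponent isolates the factor \<open>u\<^sup>2\<close> that
        cancels the Jacobian \<open>b / u\<^sup>2\<close>.\<close>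
      have "u powr (1 + s) = u powr ((s - 1) + 2)"
        by (simp add: add.commute)
      also have "\<dots> = u powr (s - 1) * u\<^sup>2"
        using u by (simp only: powr_add powr_numeral)
      finally show ?thesis
        using b u by (simp add: powr_divide powr_add)
    qed
    then have "\<bar>- b / u\<^sup>2\<bar> * ?f (b / u)
        = b / u\<^sup>2 * (exp (- u) / (b * b powr s / (u powr (s - 1) * u\<^sup>2)))"
      using b by simp
    also have "\<dots> = ?h u"
      using b u by (simp add: powr_minus exp_minus divide_simps)
    finally show ?thesis .
  qed
  have "((\<lambda>t. t powr (s - 1) / exp t) has_integral Gamma s) {0<..}"
    using Gamma_integral_real[OF s]
    by (subst has_integral_spike_set_eq[where T = "{0..}"])
      (auto intro: negligible_subset[OF negligible_sing[of 0]])
  then have h: "(?h has_integral (b powr (- s) * Gamma s)) {0<..}"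
    by (rule has_integral_mult_right)
  \<comment> \<open>The change of variables is stated for absolutely integrable functions; here this
    follows from nonnegativity.\<close>
  then have "?h absolutely_integrable_on {0<..}"
    by (intro nonnegative_absolutely_integrable_1) auto
  then have "(\<lambda>u. \<bar>- b / u\<^sup>2\<bar> * ?f (b / u)) absolutely_integrable_on {0<..} \<and>
      integral {0<..} (\<lambda>u. \<bar>- b / u\<^sup>2\<bar> * ?f (b / u)) = b powr (- s) * Gamma s"
    using integral_unique[OF h]
    by (simp only: set_integrable_cong[OF refl refl pullback] integral_cong[OF pullback])
  moreover have "((\<lambda>u. b / u) has_field_derivative - b / u\<^sup>2) (at u within {0<..})"
    if "u \<in> {0<..}" for u
    using that by (auto intro!: derivative_eq_intros simp: power2_eq_square)
  moreover have "inj_on (\<lambda>u. b / u) {0<..}"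
    using b by (auto simp: inj_on_def field_simps)
  ultimately have "?f absolutely_integrable_on ((\<lambda>u. b / u) ` {0<..}) \<and>
      integral ((\<lambda>u. b / u) ` {0<..}) ?f = b powr (- s) * Gamma s"
    by (subst has_absolute_integral_change_of_variables_1'[symmetric]) auto
  then have "?f absolutely_integrable_on {0<..}" "integral {0<..} ?f = Gamma s / b powr s"
    unfolding image by (auto simp: powr_minus field_simps)
  then show ?thesis
    by (metis has_integral_integral set_lebesgue_integral_eq_integral(1))
qed

text \<open>The factor \<open>x powr s\<close> only lowers the shape parameter from
  \<open>\<rho> / 2\<close> to \<open>\<rho> / 2 - s\<close>, so the moment is a quotient of two
  normalizing constants. The bound on \<open>s\<close> keeps the new shape positive.\<close>

lemma has_bochner_integral_scale_inv_chi2_moment: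
  fixes \<rho> t s :: real
  assumes \<rho>: "\<rho> > 0" and t: "t > 0" and s: "s < \<rho> / 2"
  shows "has_bochner_integral lborel (\<lambda>x. scale_inv_chi2_density \<rho> t x * x powr s)
           ((t * \<rho> / 2) powr s * Gamma (\<rho> / 2 - s) / Gamma (\<rho> / 2))"
proof -
  define b where "b = t * \<rho> / 2"
  have b: "b > 0" using \<rho> t by (simp add: b_def)
  define C where "C = b powr (\<rho> / 2) / Gamma (\<rho> / 2)"
  have G: "Gamma (\<rho> / 2) > 0" "Gamma (\<rho> / 2 - s) > 0" using \<rho> s by auto
  have C: "C > 0" using b G by (simp add: C_def)
  let ?g = "\<lambda>x. C * (exp (- (b / x)) / x powr (1 + (\<rho> / 2 - s)))"
  have eq: "scale_inv_chi2_density \<rho> t x * x powr s = indicator {0<..} x * ?g x" for x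
  proof (cases "x > 0")
    case True
    then have "x powr (1 + \<rho> / 2) = x powr (1 + (\<rho> / 2 - s)) * x powr s"
      by (simp add: powr_add[symmetric])
    then show ?thesis
      using True by (simp add: scale_inv_chi2_density_def b_def C_def mult.commute)
  qed (simp add: scale_inv_chi2_density_def)
  have "(?g has_integral (C * (Gamma (\<rho> / 2 - s) / b powr (\<rho> / 2 - s)))) {0<..}"
    using b s by (intro has_integral_mult_right has_integral_inverse_gamma) auto
  moreover have "C * (Gamma (\<rho> / 2 - s) / b powr (\<rho> / 2 - s))
      = b powr s * Gamma (\<rho> / 2 - s) / Gamma (\<rho> / 2)" (is "_ = ?I")
    using b by (simp add: C_def powr_diff)
  ultimately have "(?g has_integral ?I) {0<..}"
    by simp
  then have "(\<integral>\<^sup>+x. ennreal (indicator {0<..} x * ?g x) \<partial>lborel) = ennreal ?I"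
    using C by (intro nn_integral_has_integral_lebesgue) auto
  then have "has_bochner_integral lborel (\<lambda>x. indicator {0<..} x * ?g x) ?I"
    using C G by (intro has_bochner_integral_nn_integral) (auto simp: indicator_def)
  then show ?thesis
    unfolding eq b_def .
qed

lemma scale_inv_chi2_density_nonneg:
  assumes "\<rho> > 0"
  shows "scale_inv_chi2_density \<rho> t x \<ge> 0"
  using assms by (auto simp: scale_inv_chi2_density_def intro!: mult_nonneg_nonneg divide_nonneg_nonneg)

lemma has_bochner_integral_distributed_scale_inv_chi2:
  assumes "distributed M lborel X (scale_inv_chi2_density \<rho> t)"
    and "\<rho> > 0" "t > 0" "s < \<rho> / 2"
  shows "has_bochner_integral M (\<lambda>\<omega>. X \<omega> powr s)
           ((t * \<rho> / 2) powr s * Gamma (\<rho> / 2 - s) / Gamma (\<rho> / 2))"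
  using has_bochner_integral_scale_inv_chi2_moment[OF assms(2-4)]
    distributed_integrable[OF assms(1), of "\<lambda>x. x powr s"]
    distributed_integral[OF assms(1), of "\<lambda>x. x powr s"]
    scale_inv_chi2_density_nonneg[OF assms(2)]
  by (simp add: has_bochner_integral_iff)

text \<open>This is \<open>Q\<close> from the overview. For \<open>a = \<rho> / 2\<close> it equals
  the squared mean of \<open>\<psi>\<close> divided by its second moment; \<open>a - 1/2\<close> is
  the midpoint of \<open>a - 1\<close> and \<open>a\<close>.\<close>

definition Gamma_midpoint_ratio :: "real \<Rightarrow> real" where
  "Gamma_midpoint_ratio a = (Gamma (a - 1/2))\<^sup>2 / (Gamma a * Gamma (a - 1))"

lemma Gamma_midpoint_ratio_conv_exp:
  assumes "a > 1"
  shows "Gamma_midpoint_ratio a = exp (2 * ln_Gamma (a - 1/2) - ln_Gamma a - ln_Gamma (a - 1))"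
  using assms
  by (simp add: Gamma_midpoint_ratio_def Gamma_real_pos_exp exp_diff exp_double)

text \<open>\<open>Digamma\<close> is strictly concave: by the mean value theorem its increments
  over the two halves of the interval from \<open>x - 1\<close> to \<open>x\<close> are half of
  trigamma values, and trigamma is strictly decreasing.\<close>

lemma Digamma_midpoint_gt:
  fixes x :: real
  assumes x: "x > 1"
  shows "Digamma x + Digamma (x - 1) < 2 * Digamma (x - 1/2)"
proof -
  have mvt: "\<exists>z. u < z \<and> z < v \<and> Digamma v - Digamma u = (v - u) * Polygamma 1 z"
    if "0 < u" "u < v" for u v :: real
    using that by (intro MVT2) (auto intro!: derivative_eq_intros elim!: nonpos_Ints_cases)
  obtain y where y: "x - 1 < y" "y < x - 1/2"
    "Digamma (x - 1/2) - Digamma (x - 1) = (x - 1/2 - (x - 1)) * Polygamma 1 y"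
    using mvt[of "x - 1" "x - 1/2"] x by auto
  obtain z where z: "x - 1/2 < z" "Digamma x - Digamma (x - 1/2) = (x - (x - 1/2)) * Polygamma 1 z"
    using mvt[of "x - 1/2" x] x by auto
  have "Polygamma 1 z < Polygamma 1 y"
    using x y z by (intro Polygamma_real_strict_antimono) auto
  then show ?thesis
    using y z by simp
qed

lemma Gamma_midpoint_ratio_strict_mono:
  assumes "1 < a" "a < b"
  shows "Gamma_midpoint_ratio a < Gamma_midpoint_ratio b"
proof -
  let ?L = "\<lambda>x. 2 * ln_Gamma (x - 1/2) - ln_Gamma x - ln_Gamma (x - 1) :: real"
  have "?L a < ?L b"
  proof (rule DERIV_pos_imp_increasing[OF assms(2)])
    fix x assume "a \<le> x" "x \<le> b"
    with assms have x: "x > 1" by simp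
    have "(?L has_real_derivative 2 * Digamma (x - 1/2) - Digamma x - Digamma (x - 1)) (at x)"
      using x by (auto intro!: derivative_eq_intros)
    with Digamma_midpoint_gt[OF x] show "\<exists>y. (?L has_real_derivative y) (at x) \<and> y > 0"
      by (intro exI[of _ "2 * Digamma (x - 1/2) - Digamma x - Digamma (x - 1)"]) simp
  qed
  then show ?thesis
    using assms by (simp add: Gamma_midpoint_ratio_conv_exp)
qed

lemma Gamma_midpoint_ratio_le_1:
  assumes "a > 1"
  shows "Gamma_midpoint_ratio a \<le> 1"
proof -
  have "(ln \<circ> Gamma) ((1 - 1/2) *\<^sub>R a + (1/2) *\<^sub>R (a - 1))
      \<le> (1 - 1/2) * (ln \<circ> Gamma) a + 1/2 * (ln \<circ> Gamma) (a - 1)"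
    using assms by (intro convex_onD[OF log_convex_Gamma_real]) auto
  moreover have "(1 - 1/2) *\<^sub>R a + (1/2) *\<^sub>R (a - 1) = a - 1/2"
    by (simp add: field_simps)
  ultimately show ?thesis
    using assms by (simp add: Gamma_midpoint_ratio_conv_exp ln_Gamma_real_pos)
qed

text \<open>The first two moments of \<open>\<psi>\<close> are the moments of its square of orders
  1/2 and 1; \<open>\<rho> > 2\<close> makes the latter finite.\<close>

lemma variance_scale_inv_chi2_root:
  fixes \<psi> :: "'a \<Rightarrow> real"
  assumes "prob_space M" and meas: "\<psi> \<in> borel_measurable M"
    and pos: "AE \<omega> in M. \<psi> \<omega> > 0"
    and dist: "distributed M lborel (\<lambda>\<omega>. (\<psi> \<omega>)\<^sup>2) (scale_inv_chi2_density \<rho> t)"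
    and \<rho>: "\<rho> > 2" and t: "t > 0"
  shows "prob_space.variance M \<psi>
           = t * ((\<rho> / 2) / (\<rho> / 2 - 1) * (1 - Gamma_midpoint_ratio (\<rho> / 2)))"
proof -
  interpret prob_space M by fact
  define a where "a = \<rho> / 2"
  have a: "a > 1" using \<rho> by (simp add: a_def)
  have moment: "has_bochner_integral M (\<lambda>\<omega>. (\<psi> \<omega>)\<^sup>2 powr s)
      ((t * a) powr s * Gamma (a - s) / Gamma a)" if "s < a" for s
    using has_bochner_integral_distributed_scale_inv_chi2[OF dist, of s] \<rho> t that
    by (simp add: a_def)
  \<comment> \<open>The functional equation reduces the second moment to
    \<open>t * a / (a - 1)\<close>.\<close>
  have G: "Gamma a = (a - 1) * Gamma (a - 1)" "Gamma (a - 1) > 0"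
    using a Gamma_plus1[of "a - 1"] nonpos_Ints_nonpos[of "a - 1"] by auto
  have first: "has_bochner_integral M \<psi> (sqrt (t * a) * Gamma (a - 1/2) / Gamma a)"
  proof (rule has_bochner_integral_cong_AE[THEN iffD1])
    \<comment> \<open>The left side is the absolute value of \<open>\<psi> \<omega>\<close>, so
      positivity almost everywhere is what identifies it with
      \<open>\<psi> \<omega>\<close>.\<close>
    show "AE \<omega> in M. (\<psi> \<omega>)\<^sup>2 powr (1/2) = \<psi> \<omega>"
      using pos by eventually_elim (simp add: powr_half_sqrt)
  qed (use moment[of "1/2"] a t meas in \<open>auto simp: powr_half_sqrt\<close>)
  have second: "has_bochner_integral M (\<lambda>\<omega>. (\<psi> \<omega>)\<^sup>2) (t * a * Gamma (a - 1) / Gamma a)"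
    using moment[of 1] a t by simp
  have "variance \<psi> = t * a * Gamma (a - 1) / Gamma a - (sqrt (t * a) * Gamma (a - 1/2) / Gamma a)\<^sup>2"
    using first second by (subst variance_eq) (auto simp: has_bochner_integral_iff)
  also have "\<dots> = t * a / (a - 1) - t * a * (Gamma (a - 1/2))\<^sup>2 / (Gamma a)\<^sup>2"
    using a t less_imp_neq[OF G(2)] by (simp add: G(1) power_mult_distrib power_divide)
  also have "\<dots> = t * (a / (a - 1) * (1 - Gamma_midpoint_ratio a))"
    using a less_imp_neq[OF G(2)]
    by (simp add: Gamma_midpoint_ratio_def G(1) power2_eq_square divide_simps)
      (simp add: algebra_simps)
  finally show ?thesis
    by (simp add: a_def)
qed

lemma variance_factor_strict_antimono:
  assumes "1 < a" "a < b"
  shows "b / (b - 1) * (1 - Gamma_midpoint_ratio b) < a / (a - 1) * (1 - Gamma_midpoint_ratio a)"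
\<comment> \<open>Besides the two strict inequalities, the rule asks for a nonnegative second factor
  on the smaller side, hence the bound by 1 at \<open>b\<close>.\<close>
proof (rule mult_strict_mono)
  show "b / (b - 1) < a / (a - 1)"
    using assms by (simp add: field_simps)
qed (use assms Gamma_midpoint_ratio_strict_mono[OF assms] Gamma_midpoint_ratio_le_1[of b] in auto)

theorem theorem1:
  fixes \<sigma> :: real
    and M :: "real \<Rightarrow> 'a measure"
    and \<psi> :: "real \<Rightarrow> 'a \<Rightarrow> real"
  assumes "\<sigma> > 0"
    and "\<And>\<rho>. \<rho> > 4 \<Longrightarrow> prob_space (M \<rho>)"
    and "\<And>\<rho>. \<rho> > 4 \<Longrightarrow> \<psi> \<rho> \<in> borel_measurable (M \<rho>)"
    and "\<And>\<rho>. \<rho> > 4 \<Longrightarrow> AE \<omega> in M \<rho>. \<psi> \<rho> \<omega> > 0"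
    and "\<And>\<rho>. \<rho> > 4 \<Longrightarrow>
           distributed (M \<rho>) lborel (\<lambda>\<omega>. (\<psi> \<rho> \<omega>)\<^sup>2) (scale_inv_chi2_density \<rho> (1 / \<sigma>\<^sup>2))"
  shows "\<forall>\<rho>1 \<rho>2. 4 < \<rho>1 \<and> \<rho>1 < \<rho>2 \<longrightarrow>
           prob_space.variance (M \<rho>2) (\<psi> \<rho>2) < prob_space.variance (M \<rho>1) (\<psi> \<rho>1)"
proof (intro allI impI, elim conjE)
  fix \<rho>1 \<rho>2 :: real
  assume \<rho>: "4 < \<rho>1" "\<rho>1 < \<rho>2"
  have var: "prob_space.variance (M \<rho>) (\<psi> \<rho>)
      = 1 / \<sigma>\<^sup>2 * ((\<rho> / 2) / (\<rho> / 2 - 1) * (1 - Gamma_midpoint_ratio (\<rho> / 2)))"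
    if "\<rho> > 4" for \<rho>
    using that \<open>\<sigma> > 0\<close> by (intro variance_scale_inv_chi2_root assms(2-5)) auto
  show "prob_space.variance (M \<rho>2) (\<psi> \<rho>2) < prob_space.variance (M \<rho>1) (\<psi> \<rho>1)"
    unfolding var[OF \<rho>(1)] var[OF less_trans[OF \<rho>]]
    by (rule mult_strict_left_mono[OF variance_factor_strict_antimono])
      (use \<rho> \<open>\<sigma> > 0\<close> in auto)
qed

end
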